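(* Let $\mathcal{M}$ be the Bregman manifold of a regular Bregman generator $\Omega$ on an open convex set $\mathcal{X}\subset\mathbb{R}^d$, and let $\mu_0,\mu_1\in\mathcal{P}(\mathcal{M})$ be such that $\mu_0^{\mathcal{X}}$ and $\mu_1^{\mathcal{Y}}$ have finite second moments. Assume: (i) $\mu_0^{\mathcal{X}}$ is absolutely continuous with respect to the Lebesgue measure on $\mathcal{X}$; (ii) $\Omega\in L^1(\mu_0^{\mathcal{X}})$ and $\Omega^*\in L^1(\mu_1^{\mathcal{Y}})$. Let $Df$ be the ($\mu_0^{\mathcal{X}}$-a.e. unique) gradient of a convex function (Brenier map) which pushes $\mu_0^{\mathcal{X}}$ forward to $\mu_1^{\mathcal{Y}}$ and is $\mathscr{W}_2$-optimal for the pair $(\mu_0^{\mathcal{X}},\mu_1^{\mathcal{Y}})$, that is $$\int_{\mathcal{X}}|x-Df(x)|^2\,d\mu_0^{\mathcal{X}}(x)=\mathscr{W}_2^2(\mu_0^{\mathcal{X}},\mu_1^{\mathcal{Y}});$$ note that $Df(x)\in\mathcal{Y}$ for $\mu_0^{\mathcal{X}}$-a.e. $x$. Then the optimal transport problem $$\mathscr{B}(\mu_0,\mu_1)=\inf_{\pi\in\Pi(\mu_0,\mu_1)}\int_{\mathcal{M}\times\mathcal{M}}\mathbf{B}(p,q)\,d\pi(p,q)$$ is solved by the deterministic coupling $\pi=(\mathrm{Id},T)_{\#}\mu_0$ induced by the ($\mu_0$-a.e. defined) transport map $T=(\iota^* )^{-1}\circ Df\circ\iota:\mathcal{M}\to\mathcal{M}$.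 In particular, $$\mathscr{B}(\mu_0,\mu_1)=\int_{\mathcal{M}}\mathbf{B}(p,T(p))\,d\mu_0(p)=\frac12\mathscr{W}_2^2(\mu_0^{\mathcal{X}},\mu_1^{\mathcal{Y}})+\int_{\mathcal{X}}\widetilde{\Omega}\,d\mu_0^{\mathcal{X}}+\int_{\mathcal{Y}}\widetilde{\Omega^*}\,d\mu_1^{\mathcal{Y}},$$ where $\widetilde{\Omega}(x)=\Omega(x)-\frac12|x|^2$ and $\widetilde{\Omega^*}(y)=\Omega^*(y)-\frac12|y|^2$.
   Context: $D$ and $D^2$ denote Euclidean gradient and Hessian. A regular Bregman generator on an open convex set $\mathcal{X}\subset\mathbb{R}^d$ is a smooth convex function $\Omega:\mathcal{X}\to\mathbb{R}$ with $D^2\Omega$ positive definite everywhere and with $\mathcal{Y}:=D\Omega(\mathcal{X})$ convex. Then $D\Omega:\mathcal{X}\to\mathcal{Y}$ is a diffeomorphism onto the open convex set $\mathcal{Y}$, with inverse $D\Omega^*$, where $\Omega^*(y)=x\cdot y-\Omega(x)$ for $y=D\Omega(x)\in\mathcal{Y}$. The Bregman manifold $\mathcal{M}$ is the smooth $d$-dimensional manifold with two global charts, the primal coordinate map $\iota:\mathcal{M}\to\mathcal{X}$ and the dual coordinate map $\iota^*=D\Omega\circ\iota:\mathcal{M}\to\mathcal{Y}$; write $x_p=\iota(p)$, $y_p=\iota^*(p)$. The Bregman divergence on $\mathcal{M}$ is $\mathbf{B}(p,q)=\Omega(x_p)+\Omega^*(y_q)-x_p\cdot y_q\ge 0$. $\mathcal{P}(E)$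 denotes the Borel probability measures on $E$; $T_\#\mu$ denotes pushforward; $\Pi(\mu_0,\mu_1)$ denotes the set of couplings (joint laws with marginals $\mu_0,\mu_1$). For $\mu\in\mathcal{P}(\mathcal{M})$, $\mu^{\mathcal{X}}=\iota_\#\mu$ and $\mu^{\mathcal{Y}}=(\iota^* )_\#\mu$. $\mathscr{W}_2$ is the Euclidean $2$-Wasserstein distance on $\mathbb{R}^d$: $\mathscr{W}_2^2(\mu,\nu)=\inf_{\pi\in\Pi(\mu,\nu)}\int|x-y|^2\,d\pi$. *)

theory Defs
  imports "HOL-Probability.Probability"
begin

definition grad :: "('a::real_inner \<Rightarrow> real) \<Rightarrow> 'a \<Rightarrow> 'a" where
  "grad f x = (THE D. GDERIV f x :> D)"

text \<open>The Hessian as the linear map \<open>v \<mapsto> D\<^sup>2f(x) v\<close>, i.e. the derivative of the gradient map.\<close>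

definition hessian :: "('a::real_inner \<Rightarrow> real) \<Rightarrow> 'a \<Rightarrow> 'a \<Rightarrow> 'a" where
  "hessian f x = frechet_derivative (grad f) (at x)"

definition positive_definite :: "('a::real_inner \<Rightarrow> 'a) \<Rightarrow> bool" where
  "positive_definite A \<longleftrightarrow> linear A \<and> (\<forall>v w. A v \<bullet> w = v \<bullet> A w) \<and> (\<forall>v. v \<noteq> 0 \<longrightarrow> v \<bullet> A v > 0)"

text \<open>All iterated directional derivatives up to order \<open>k\<close> exist and are continuous; for an open
  subset of a finite-dimensional space this is the class \<open>C\<^sup>k\<close>.\<close>

primrec Ck_on :: "nat \<Rightarrow> 'a::real_normed_vector set \<Rightarrow> ('a \<Rightarrow> 'b::real_normed_vector) \<Rightarrow> bool" where
  "Ck_on 0 S f \<longleftrightarrow> continuous_on S f"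
| "Ck_on (Suc k) S f \<longleftrightarrow>
     (\<forall>x\<in>S. f differentiable (at x)) \<and> (\<forall>v. Ck_on k S (\<lambda>x. frechet_derivative f (at x) v))"

definition smooth_on :: "'a::real_normed_vector set \<Rightarrow> ('a \<Rightarrow> 'b::real_normed_vector) \<Rightarrow> bool" where
  "smooth_on S f \<longleftrightarrow> (\<forall>k. Ck_on k S f)"

text \<open>The generator is represented by a total function \<open>\<Omega>\<close>; only its values on \<open>X\<close> are used.\<close>

definition regular_bregman_generator :: "'a::euclidean_space set \<Rightarrow> ('a \<Rightarrow> real) \<Rightarrow> bool" where
  "regular_bregman_generator X \<Omega> \<longleftrightarrow>
     open X \<and> convex X \<and> smooth_on X \<Omega> \<and> convex_on X \<Omega> \<and>
     (\<forall>x\<in>X. positive_definite (hessian \<Omega> x)) \<and> convex (grad \<Omega> ` X)"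

definition dual_domain :: "'a::euclidean_space set \<Rightarrow> ('a \<Rightarrow> real) \<Rightarrow> 'a set" where
  "dual_domain X \<Omega> = grad \<Omega> ` X"

text \<open>\<open>\<Omega>\<^sup>*(y) = x \<bullet> y - \<Omega>(x)\<close> where \<open>x \<in> X\<close> is the point with \<open>y = D\<Omega>(x)\<close>;
  meaningful for \<open>y\<close> in the dual domain.\<close>

definition legendre :: "'a::euclidean_space set \<Rightarrow> ('a \<Rightarrow> real) \<Rightarrow> 'a \<Rightarrow> real" where
  "legendre X \<Omega> y = (let x = inv_into X (grad \<Omega>) y in x \<bullet> y - \<Omega> x)"

text \<open>A Bregman manifold with point set \<open>M\<close> and primal chart \<open>\<iota>\<close>. Its smooth structure is the one
  generated by the single global chart \<open>\<iota>\<close>, so it carries no data beyond the homeomorphism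
  \<open>\<iota>\<close> of \<open>M\<close> (with the subspace topology) onto the open set \<open>X\<close>.\<close>

definition bregman_manifold ::
  "'m::topological_space set \<Rightarrow> 'a::euclidean_space set \<Rightarrow> ('a \<Rightarrow> real) \<Rightarrow> ('m \<Rightarrow> 'a) \<Rightarrow> bool" where
  "bregman_manifold M X \<Omega> \<iota> \<longleftrightarrow>
     regular_bregman_generator X \<Omega> \<and> (\<exists>\<kappa>. homeomorphism M X \<iota> \<kappa>)"

definition dual_chart :: "('a::euclidean_space \<Rightarrow> real) \<Rightarrow> ('m \<Rightarrow> 'a) \<Rightarrow> 'm \<Rightarrow> 'a" where
  "dual_chart \<Omega> \<iota> = grad \<Omega> \<circ> \<iota>"

text \<open>Nonnegative on \<open>M \<times> M\<close> by convexity of \<open>\<Omega>\<close>, so \<open>ennreal\<close> loses nothing when it serves as a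
  transport cost.\<close>

definition bregman_div ::
  "'a::euclidean_space set \<Rightarrow> ('a \<Rightarrow> real) \<Rightarrow> ('m \<Rightarrow> 'a) \<Rightarrow> 'm \<Rightarrow> 'm \<Rightarrow> real" where
  "bregman_div X \<Omega> \<iota> p q =
     \<Omega> (\<iota> p) + legendre X \<Omega> (dual_chart \<Omega> \<iota> q) - \<iota> p \<bullet> dual_chart \<Omega> \<iota> q"

definition borel_probs :: "'m::topological_space set \<Rightarrow> 'm measure set" where
  "borel_probs M = {\<mu>. prob_space \<mu> \<and> sets \<mu> = sets (restrict_space borel M)}"

definition couplings :: "'p measure \<Rightarrow> 'q measure \<Rightarrow> ('p \<times> 'q) measure set" where
  "couplings \<mu> \<nu> =
     {\<pi>. sets \<pi> = sets (\<mu> \<Otimes>\<^sub>M \<nu>) \<and> distr \<pi> \<mu> fst = \<mu> \<and> distr \<pi> \<nu> snd = \<nu>}"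

definition transport_cost ::
  "('p \<Rightarrow> 'q \<Rightarrow> ennreal) \<Rightarrow> 'p measure \<Rightarrow> 'q measure \<Rightarrow> ennreal" where
  "transport_cost c \<mu> \<nu> = (INF \<pi>\<in>couplings \<mu> \<nu>. \<integral>\<^sup>+z. c (fst z) (snd z) \<partial>\<pi>)"

definition optimal_coupling ::
  "('p \<Rightarrow> 'q \<Rightarrow> ennreal) \<Rightarrow> 'p measure \<Rightarrow> 'q measure \<Rightarrow> ('p \<times> 'q) measure \<Rightarrow> bool" where
  "optimal_coupling c \<mu> \<nu> \<pi> \<longleftrightarrow>
     \<pi> \<in> couplings \<mu> \<nu> \<and> (\<integral>\<^sup>+z. c (fst z) (snd z) \<partial>\<pi>) = transport_cost c \<mu> \<nu>"

definition wasserstein2_sq :: "'a::euclidean_space measure \<Rightarrow> 'a measure \<Rightarrow> ennreal" where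
  "wasserstein2_sq = transport_cost (\<lambda>x y. ennreal ((norm (x - y))\<^sup>2))"

definition finite_second_moment :: "'a::euclidean_space measure \<Rightarrow> bool" where
  "finite_second_moment \<mu> \<longleftrightarrow> integrable \<mu> (\<lambda>x. (norm x)\<^sup>2)"

text \<open>\<open>g\<close> is a Borel version of the \<open>\<mu>\<close>-a.e. defined gradient of a convex function. A proper convex
  function with values in \<open>(-\<infinity>, \<infinity>]\<close> is represented by its effective domain \<open>C\<close> together with the
  real-valued restriction \<open>f\<close> to \<open>C\<close>; differentiability only makes sense in the interior of \<open>C\<close>.\<close>

definition ae_convex_gradient :: "'a::euclidean_space measure \<Rightarrow> ('a \<Rightarrow> 'a) \<Rightarrow> bool" where
  "ae_convex_gradient \<mu> g \<longleftrightarrow> g \<in> borel_measurable borel \<and>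
     (\<exists>C f. convex_on C f \<and> (AE x in \<mu>. x \<in> interior C \<and> (GDERIV f x :> g x)))"

definition optimal_brenier_map ::
  "'a::euclidean_space measure \<Rightarrow> 'a measure \<Rightarrow> ('a \<Rightarrow> 'a) \<Rightarrow> bool" where
  "optimal_brenier_map \<mu> \<nu> g \<longleftrightarrow>
     ae_convex_gradient \<mu> g \<and> distr \<mu> borel g = \<nu> \<and>
     (\<integral>\<^sup>+x. ennreal ((norm (x - g x))\<^sup>2) \<partial>\<mu>) = wasserstein2_sq \<mu> \<nu>"

text \<open>The map \<open>(\<iota>\<^sup>*)\<^sup>-\<^sup>1 \<circ> g \<circ> \<iota>\<close> is only defined where \<open>g (\<iota> p)\<close> lies in the dual domain; on
  the remaining (null) set it is extended by the identity so as to be a total map of \<open>M\<close> into \<open>M\<close>.\<close>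

definition bregman_transport_map ::
  "'m set \<Rightarrow> 'a::euclidean_space set \<Rightarrow> ('a \<Rightarrow> real) \<Rightarrow> ('m \<Rightarrow> 'a) \<Rightarrow> ('a \<Rightarrow> 'a) \<Rightarrow> 'm \<Rightarrow> 'm" where
  "bregman_transport_map M X \<Omega> \<iota> g p =
     (if g (\<iota> p) \<in> dual_domain X \<Omega> then inv_into M (dual_chart \<Omega> \<iota>) (g (\<iota> p)) else p)"

end

theory Submission
  imports Defs
begin

text \<open>
  Write the Bregman divergence in the mixed coordinates \<open>x = x\<^sub>p\<close>, \<open>y = y\<^sub>q\<close>, where it is
  \<open>\<Omega>(x) + \<Omega>\<^sup>*(y) - x \<bullet> y\<close>. Since \<open>x \<bullet> y = |x|\<^sup>2/2 + |y|\<^sup>2/2 - |x - y|\<^sup>2/2\<close>, this cost is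
  half the squared Euclidean distance plus a function of \<open>x\<close> alone and a function of \<open>y\<close> alone.
  The integrals of the last two depend on the marginals only, so on all couplings the Bregman
  cost and half the quadratic cost differ by one and the same finite constant
  (\<open>coupling_cost_split\<close>).

  A coupling of \<open>\<mu>\<^sub>0\<close>, \<open>\<mu>\<^sub>1\<close> is carried by \<open>\<iota> \<times> \<iota>\<^sup>*\<close> to a coupling of the images
  (\<open>coupling_pushforward\<close>), so its Bregman cost is at least the constant plus
  \<open>\<W>\<^sub>2\<^sup>2/2\<close>. The graph of \<open>T\<close> is carried to the graph of \<open>Df\<close>, which attains
  \<open>\<W>\<^sub>2\<^sup>2\<close>; hence it is optimal and its cost is the asserted value.

  The remaining ingredients are geometric. The Hessian being positive definite, \<open>D\<Omega>\<close> is strictly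
  monotone on the convex set \<open>X\<close>. This gives the tangent inequality, hence the nonnegativity of the
  divergence, and injectivity of \<open>D\<Omega>\<close>. By invariance of domain the dual chart is then a
  homeomorphism onto an open set, so that \<open>T\<close> is Borel and measures on \<open>M\<close> are determined by
  their images under the chart (\<open>measure_eqI_homeomorphism\<close>).
\<close>

section \<open>The gradient of a regular generator\<close>

lemma GDERIV_grad:
  fixes f :: "'a::euclidean_space \<Rightarrow> real"
  assumes "f differentiable (at x)"
  shows "GDERIV f x :> grad f x"
proof -
  obtain f' where f': "(f has_derivative f') (at x)"
    using assms by (auto simp: differentiable_def)
  then interpret bounded_linear f' by (rule has_derivative_bounded_linear)
  have "f' h = h \<bullet> (\<Sum>b\<in>Basis. f' b *\<^sub>R b)" for h
  proof -
    have "f' h = f' (\<Sum>b\<in>Basis. (h \<bullet> b) *\<^sub>R b)" by (simp add: euclidean_representation)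
    also have "\<dots> = h \<bullet> (\<Sum>b\<in>Basis. f' b *\<^sub>R b)"
      by (simp add: sum scaleR inner_sum_right mult.commute)
    finally show ?thesis .
  qed
  then have "GDERIV f x :> (\<Sum>b\<in>Basis. f' b *\<^sub>R b)"
    using f' unfolding gderiv_def by (metis (no_types, lifting) ext)
  moreover have "D = E" if "GDERIV f x :> D" "GDERIV f x :> E" for D E
    using has_derivative_unique[OF that[unfolded gderiv_def]]
    by (metis vector_eq_rdot inner_commute)
  ultimately show ?thesis
    unfolding grad_def by (blast intro: theI)
qed

lemma grad_inner_eq_frechet_derivative:
  fixes f :: "'a::euclidean_space \<Rightarrow> real"
  assumes "f differentiable (at x)"
  shows "grad f x \<bullet> v = frechet_derivative f (at x) v"
  using frechet_derivative_at[OF GDERIV_grad[OF assms, unfolded gderiv_def]]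
  by (metis inner_commute)

text \<open>On \<open>S\<close> the gradient is the combination of basis vectors whose coefficients are the partial
  derivatives, which are differentiable by hypothesis. The gradient has arbitrary values off \<open>S\<close>,
  so openness is what lets the two maps be compared near each point.\<close>

lemma grad_differentiable:
  fixes f :: "'a::euclidean_space \<Rightarrow> real"
  assumes "open S" "Ck_on 2 S f" "x \<in> S"
  shows "grad f differentiable (at x)"
proof -
  define G where "G = (\<lambda>x. \<Sum>b\<in>Basis. frechet_derivative f (at x) b *\<^sub>R b)"
  have diff: "f differentiable (at y)" if "y \<in> S" for y
    using assms(2) that by (simp add: numeral_2_eq_2)
  have "G y = grad f y" if "y \<in> S" for y
    by (simp add: G_def euclidean_representation
        flip: grad_inner_eq_frechet_derivative[OF diff[OF that]])
  moreover have "G differentiable (at x)"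
    unfolding G_def using assms(2,3)
    by (intro differentiable_sum ballI differentiable_scaleR) (auto simp: numeral_2_eq_2)
  ultimately show ?thesis
    unfolding differentiable_def
    using has_derivative_transform_within_open[OF _ assms(1,3), of G _ UNIV "grad f"] by blast
qed

lemma convex_segment_mem:
  assumes "convex S" "x \<in> S" "y \<in> S" "0 \<le> t" "t \<le> 1"
  shows "x + t *\<^sub>R (y - x) \<in> S"
  using convexD_alt[OF assms(1-5)] by (simp add: algebra_simps)

context
  fixes X :: "'a::euclidean_space set" and \<Omega> :: "'a \<Rightarrow> real"
  assumes reg: "regular_bregman_generator X \<Omega>"
begin

lemma generator_open: "open X" and generator_convex: "convex X"
  using reg by (auto simp: regular_bregman_generator_def)

lemma generator_Ck_2: "Ck_on 2 X \<Omega>"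
  using reg by (auto simp: regular_bregman_generator_def smooth_on_def)

lemma generator_GDERIV: "x \<in> X \<Longrightarrow> GDERIV \<Omega> x :> grad \<Omega> x"
  using generator_Ck_2 by (intro GDERIV_grad) (simp add: numeral_2_eq_2)

lemma generator_grad_has_derivative:
  assumes "x \<in> X"
  shows "(grad \<Omega> has_derivative hessian \<Omega> x) (at x)"
  unfolding hessian_def
  using grad_differentiable[OF generator_open generator_Ck_2 assms]
  by (simp add: frechet_derivative_works)

lemma continuous_on_generator_grad: "continuous_on X (grad \<Omega>)"
  by (meson generator_grad_has_derivative has_derivative_continuous continuous_at_imp_continuous_on)

text \<open>Mean value theorem for \<open>t \<mapsto> D\<Omega>(x + t(y - x)) \<bullet> (y - x)\<close>, whose derivative is the Hessian
  form in the direction \<open>y - x\<close>.\<close>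

lemma grad_strictly_monotone:
  assumes "x \<in> X" "y \<in> X" "x \<noteq> y"
  shows "(grad \<Omega> y - grad \<Omega> x) \<bullet> (y - x) > 0"
proof -
  let ?p = "\<lambda>t. x + t *\<^sub>R (y - x)"
  let ?h = "\<lambda>t. hessian \<Omega> (?p t) (y - x) \<bullet> (y - x)"
  have mem: "?p t \<in> X" if "0 \<le> t" "t \<le> 1" for t
    using convex_segment_mem[OF generator_convex assms(1,2) that] .
  have der: "((\<lambda>t. grad \<Omega> (?p t) \<bullet> (y - x)) has_real_derivative ?h t) (at t)"
    if t: "0 \<le> t" "t \<le> 1" for t
  proof -
    note G = generator_grad_has_derivative[OF mem[OF t]]
    interpret bounded_linear "hessian \<Omega> (?p t)" by (rule has_derivative_bounded_linear[OF G])
    have "(?p has_derivative (\<lambda>s. s *\<^sub>R (y - x))) (at t)"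
      by (auto intro!: derivative_eq_intros)
    from has_derivative_inner_left[OF has_derivative_compose[OF this G], of "y - x"]
    show ?thesis
      by (simp add: has_field_derivative_def scaleR mult_commute_abs)
  qed
  obtain z where z: "0 < z" "z < 1"
    "grad \<Omega> (?p 1) \<bullet> (y - x) - grad \<Omega> (?p 0) \<bullet> (y - x) = (1 - 0) * ?h z"
    using MVT2[of 0 1 "\<lambda>t. grad \<Omega> (?p t) \<bullet> (y - x)" ?h] der by auto
  have "?h z > 0"
    using reg mem[of z] z assms(3)
    by (auto simp: regular_bregman_generator_def positive_definite_def inner_commute)
  with z(3) show ?thesis by (simp add: inner_diff_left)
qed

lemma inj_on_grad: "inj_on (grad \<Omega>) X"
  using grad_strictly_monotone by (force simp: inj_on_def)

lemma generator_above_tangent: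
  assumes "x \<in> X" "y \<in> X"
  shows "\<Omega> x + grad \<Omega> x \<bullet> (y - x) \<le> \<Omega> y"
proof (cases "x = y")
  case False
  let ?p = "\<lambda>t. x + t *\<^sub>R (y - x)"
  have mem: "?p t \<in> X" if "0 \<le> t" "t \<le> 1" for t
    using convex_segment_mem[OF generator_convex assms that] .
  have der: "((\<lambda>t. \<Omega> (?p t)) has_real_derivative grad \<Omega> (?p t) \<bullet> (y - x)) (at t)"
    if t: "0 \<le> t" "t \<le> 1" for t
  proof -
    have "(?p has_derivative (\<lambda>s. s *\<^sub>R (y - x))) (at t)"
      by (auto intro!: derivative_eq_intros)
    from has_derivative_compose[OF this generator_GDERIV[OF mem[OF t], unfolded gderiv_def]]
    show ?thesis
      by (simp add: has_field_derivative_def inner_commute mult_commute_abs)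
  qed
  obtain z where z: "0 < z" "z < 1" "\<Omega> (?p 1) - \<Omega> (?p 0) = (1 - 0) * (grad \<Omega> (?p z) \<bullet> (y - x))"
    using MVT2[of 0 1 "\<lambda>t. \<Omega> (?p t)" "\<lambda>t. grad \<Omega> (?p t) \<bullet> (y - x)"] der by auto
  \<comment> \<open>The slope at the intermediate point dominates the slope at \<open>x\<close> by monotonicity.\<close>
  have "0 < (grad \<Omega> (?p z) - grad \<Omega> x) \<bullet> (z *\<^sub>R (y - x))"
    using grad_strictly_monotone[OF assms(1) mem[of z]] z False by simp
  then have "grad \<Omega> x \<bullet> (y - x) \<le> grad \<Omega> (?p z) \<bullet> (y - x)"
    using z(1) by (simp add: zero_less_mult_iff inner_diff_left)
  with z(3) show ?thesis by simp
qed simp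

lemma legendre_grad: "x \<in> X \<Longrightarrow> legendre X \<Omega> (grad \<Omega> x) = x \<bullet> grad \<Omega> x - \<Omega> x"
  by (simp add: legendre_def inv_into_f_f[OF inj_on_grad])

lemma bregman_div_nonneg:
  assumes "\<iota> p \<in> X" "\<iota> q \<in> X"
  shows "0 \<le> bregman_div X \<Omega> \<iota> p q"
  using generator_above_tangent[OF assms(2,1)] assms
  by (simp add: bregman_div_def dual_chart_def legendre_grad inner_diff_right inner_commute)

lemma open_dual_domain: "open (dual_domain X \<Omega>)"
  unfolding dual_domain_def
  by (rule invariance_of_domain[OF continuous_on_generator_grad generator_open inj_on_grad])

lemma dual_chart_homeomorphism:
  assumes "homeomorphism M X \<iota> \<kappa>"
  obtains \<kappa>' where "homeomorphism M (dual_domain X \<Omega>) (dual_chart \<Omega> \<iota>) \<kappa>'"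
proof -
  obtain h where "homeomorphism X (dual_domain X \<Omega>) (grad \<Omega>) h"
    using invariance_of_domain_homeomorphism[OF generator_open continuous_on_generator_grad
        order_refl inj_on_grad] unfolding dual_domain_def by blast
  from homeomorphism_compose[OF assms this] show ?thesis
    by (intro that) (simp add: dual_chart_def)
qed

end

section \<open>Measures in a global chart\<close>

lemma homeomorphism_measurable:
  fixes f :: "'m::topological_space \<Rightarrow> 'b::topological_space"
  assumes "homeomorphism M Y f g" "sets \<mu> = sets (restrict_space borel M)"
  shows "f \<in> borel_measurable \<mu>"
  using borel_measurable_continuous_on_restrict[of M f] assms measurable_cong_sets[OF assms(2) refl]
  by (auto simp: homeomorphism_def)

text \<open>A Borel subset of \<open>M\<close> is the preimage of its image in the chart, and that image is Borel
  because the inverse chart is continuous on the Borel set \<open>Y\<close>.\<close>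

lemma measure_eqI_homeomorphism:
  fixes f :: "'m::topological_space \<Rightarrow> 'b::topological_space"
  assumes hom: "homeomorphism M Y f g" and Y: "Y \<in> sets borel"
    and \<mu>: "sets \<mu> = sets (restrict_space borel M)"
    and \<nu>: "sets \<nu> = sets (restrict_space borel M)"
    and eq: "distr \<mu> borel f = distr \<nu> borel f"
  shows "\<mu> = \<nu>"
proof (rule measure_eqI)
  show "sets \<mu> = sets \<nu>" using \<mu> \<nu> by simp
next
  fix A assume A: "A \<in> sets \<mu>"
  note f = homeomorphism_measurable[OF hom]
  have sp: "space \<mu> = M" "space \<nu> = M"
    using sets_eq_imp_space_eq[OF \<mu>] sets_eq_imp_space_eq[OF \<nu>] by (auto simp: space_restrict_space)
  obtain A' where A': "A' \<in> sets borel" "A = M \<inter> A'"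
    using A by (auto simp: \<mu> sets_restrict_space)
  have "g \<in> borel_measurable (restrict_space borel Y)"
    using hom by (intro borel_measurable_continuous_on_restrict) (auto simp: homeomorphism_def)
  from measurable_sets[OF this A'(1)] have "g -` A' \<inter> Y \<in> sets borel"
    using Y by (auto simp: space_restrict_space sets_restrict_space_iff)
  moreover have "g -` A' \<inter> Y = f ` A"
    using hom A'(2) by (force simp: homeomorphism_def)
  ultimately have fA: "f ` A \<in> sets borel" by simp
  have pre: "f -` (f ` A) \<inter> M = A"
    using hom A'(2) unfolding homeomorphism_def by (auto simp: image_iff) metis+
  have "emeasure \<mu> A = emeasure (distr \<mu> borel f) (f ` A)"
    using fA by (simp add: emeasure_distr[OF f[OF \<mu>]] sp pre)
  also have "\<dots> = emeasure \<nu> A"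
    using fA by (simp add: eq emeasure_distr[OF f[OF \<nu>]] sp pre)
  finally show "emeasure \<mu> A = emeasure \<nu> A" .
qed

section \<open>Couplings\<close>

lemma couplings_measurable:
  assumes "\<pi> \<in> couplings \<mu> \<nu>"
  shows "fst \<in> measurable \<pi> \<mu>" "snd \<in> measurable \<pi> \<nu>"
proof -
  have "sets \<pi> = sets (\<mu> \<Otimes>\<^sub>M \<nu>)" using assms by (simp add: couplings_def)
  then show "fst \<in> measurable \<pi> \<mu>" "snd \<in> measurable \<pi> \<nu>"
    using measurable_cong_sets[of \<pi> "\<mu> \<Otimes>\<^sub>M \<nu>"] by auto
qed

lemma couplings_marginal_integrals:
  fixes f :: "'p \<Rightarrow> real" and g :: "'q \<Rightarrow> real"
  assumes \<pi>: "\<pi> \<in> couplings \<mu> \<nu>"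
  shows "integrable \<mu> f \<Longrightarrow> integrable \<pi> (\<lambda>z. f (fst z)) \<and> (\<integral>z. f (fst z) \<partial>\<pi>) = (\<integral>p. f p \<partial>\<mu>)"
    and "integrable \<nu> g \<Longrightarrow> integrable \<pi> (\<lambda>z. g (snd z)) \<and> (\<integral>z. g (snd z) \<partial>\<pi>) = (\<integral>q. g q \<partial>\<nu>)"
proof -
  have eq: "distr \<pi> \<mu> fst = \<mu>" "distr \<pi> \<nu> snd = \<nu>" using \<pi> by (auto simp: couplings_def)
  note [measurable] = couplings_measurable[OF \<pi>]
  show "integrable \<pi> (\<lambda>z. f (fst z)) \<and> (\<integral>z. f (fst z) \<partial>\<pi>) = (\<integral>p. f p \<partial>\<mu>)" if "integrable \<mu> f"
    using integrable_distr_eq[of fst \<pi> \<mu> f] integral_distr[of fst \<pi> \<mu> f] that by (simp add: eq)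
  show "integrable \<pi> (\<lambda>z. g (snd z)) \<and> (\<integral>z. g (snd z) \<partial>\<pi>) = (\<integral>q. g q \<partial>\<nu>)" if "integrable \<nu> g"
    using integrable_distr_eq[of snd \<pi> \<nu> g] integral_distr[of snd \<pi> \<nu> g] that by (simp add: eq)
qed

lemma coupling_pushforward:
  assumes \<pi>: "\<pi> \<in> couplings \<mu> \<nu>"
    and u[measurable]: "u \<in> measurable \<mu> \<mu>'" and v[measurable]: "v \<in> measurable \<nu> \<nu>'"
  shows "distr \<pi> (\<mu>' \<Otimes>\<^sub>M \<nu>') (\<lambda>z. (u (fst z), v (snd z)))
    \<in> couplings (distr \<mu> \<mu>' u) (distr \<nu> \<nu>' v)"
proof -
  note [measurable] = couplings_measurable[OF \<pi>]
  have eq: "distr \<pi> \<mu> fst = \<mu>" "distr \<pi> \<nu> snd = \<nu>" using \<pi> by (auto simp: couplings_def)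
  let ?\<pi>' = "distr \<pi> (\<mu>' \<Otimes>\<^sub>M \<nu>') (\<lambda>z. (u (fst z), v (snd z)))"
  have "distr ?\<pi>' (distr \<mu> \<mu>' u) fst = distr ?\<pi>' \<mu>' fst"
    by (rule distr_cong) auto
  also have "\<dots> = distr (distr \<pi> \<mu> fst) \<mu>' u"
    by (simp add: distr_distr o_def)
  finally have 1: "distr ?\<pi>' (distr \<mu> \<mu>' u) fst = distr \<mu> \<mu>' u" by (simp only: eq)
  have "distr ?\<pi>' (distr \<nu> \<nu>' v) snd = distr ?\<pi>' \<nu>' snd"
    by (rule distr_cong) auto
  also have "\<dots> = distr (distr \<pi> \<nu> snd) \<nu>' v"
    by (simp add: distr_distr o_def)
  finally have 2: "distr ?\<pi>' (distr \<nu> \<nu>' v) snd = distr \<nu> \<nu>' v" by (simp only: eq)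
  have "sets ?\<pi>' = sets (distr \<mu> \<mu>' u \<Otimes>\<^sub>M distr \<nu> \<nu>' v)"
    unfolding sets_distr by (intro sets_pair_measure_cong) auto
  with 1 2 show ?thesis by (simp add: couplings_def)
qed

lemma graph_coupling:
  assumes T: "T \<in> measurable \<mu> \<nu>" and push: "distr \<mu> \<nu> T = \<nu>"
  shows "distr \<mu> (\<mu> \<Otimes>\<^sub>M \<nu>) (\<lambda>p. (p, T p)) \<in> couplings \<mu> \<nu>"
proof -
  let ?G = "distr \<mu> (\<mu> \<Otimes>\<^sub>M \<nu>) (\<lambda>p. (p, T p))"
  have g: "(\<lambda>p. (p, T p)) \<in> measurable \<mu> (\<mu> \<Otimes>\<^sub>M \<nu>)"
    using T by (intro measurable_Pair) auto
  have 1: "distr ?G \<mu> fst = \<mu>"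
    using distr_distr[OF measurable_fst g] by (simp add: o_def)
  have 2: "distr ?G \<nu> snd = \<nu>"
    using distr_distr[OF measurable_snd g] push by (simp add: o_def)
  show ?thesis
    unfolding couplings_def using 1 2 sets_distr by blast
qed

text \<open>The polarisation identity integrated against a coupling: the first two terms on the right
  depend on the marginals only.\<close>

lemma coupling_cost_split:
  fixes u :: "'p \<Rightarrow> 'a::euclidean_space" and v :: "'q \<Rightarrow> 'a"
    and \<phi> :: "'p \<Rightarrow> real" and \<psi> :: "'q \<Rightarrow> real"
  assumes \<pi>: "\<pi> \<in> couplings \<mu> \<nu>"
    and \<phi>: "integrable \<mu> \<phi>" and \<psi>: "integrable \<nu> \<psi>"
    and u[measurable]: "u \<in> borel_measurable \<mu>" and v[measurable]: "v \<in> borel_measurable \<nu>"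
    and u2: "integrable \<mu> (\<lambda>p. (norm (u p))\<^sup>2)" and v2: "integrable \<nu> (\<lambda>q. (norm (v q))\<^sup>2)"
  shows "integrable \<pi> (\<lambda>z. (norm (u (fst z) - v (snd z)))\<^sup>2)"
    and "integrable \<pi> (\<lambda>z. \<phi> (fst z) + \<psi> (snd z) - u (fst z) \<bullet> v (snd z))"
    and "(\<integral>z. \<phi> (fst z) + \<psi> (snd z) - u (fst z) \<bullet> v (snd z) \<partial>\<pi>) =
      (\<integral>p. \<phi> p - 1/2 * (norm (u p))\<^sup>2 \<partial>\<mu>) + (\<integral>q. \<psi> q - 1/2 * (norm (v q))\<^sup>2 \<partial>\<nu>)
      + 1/2 * (\<integral>z. (norm (u (fst z) - v (snd z)))\<^sup>2 \<partial>\<pi>)"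
proof -
  let ?d = "\<lambda>z. (norm (u (fst z) - v (snd z)))\<^sup>2"
  let ?c = "\<lambda>z. \<phi> (fst z) + \<psi> (snd z) - u (fst z) \<bullet> v (snd z)"
  let ?f = "\<lambda>p. \<phi> p - 1/2 * (norm (u p))\<^sup>2" and ?g = "\<lambda>q. \<psi> q - 1/2 * (norm (v q))\<^sup>2"
  note [measurable] = couplings_measurable[OF \<pi>]
  note L = couplings_marginal_integrals(1)[OF \<pi>] and R = couplings_marginal_integrals(2)[OF \<pi>]
  have bound: "(norm (a - b))\<^sup>2 \<le> 2 * (norm a)\<^sup>2 + 2 * (norm b)\<^sup>2" for a b :: 'a
  proof -
    have "(norm (a + b))\<^sup>2 + (norm (a - b))\<^sup>2 = 2 * (norm a)\<^sup>2 + 2 * (norm b)\<^sup>2"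
      by (simp add: power2_norm_eq_inner inner_add inner_diff inner_commute)
    then show ?thesis using zero_le_power2[of "norm (a + b)"] by linarith
  qed
  show d: "integrable \<pi> ?d"
  proof (rule Bochner_Integration.integrable_bound)
    show "integrable \<pi> (\<lambda>z. 2 * (norm (u (fst z)))\<^sup>2 + 2 * (norm (v (snd z)))\<^sup>2)"
      using L[OF u2] R[OF v2] by simp
    show "AE z in \<pi>. norm (?d z) \<le> norm (2 * (norm (u (fst z)))\<^sup>2 + 2 * (norm (v (snd z)))\<^sup>2)"
      using bound by auto
  qed measurable
  have c_eq: "?c = (\<lambda>z. ?f (fst z) + ?g (snd z) + 1/2 * ?d z)"
    by (rule ext) (simp add: dot_norm_neg field_simps)
  have f: "integrable \<mu> ?f" and g: "integrable \<nu> ?g"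
    using \<phi> \<psi> u2 v2
    by (intro Bochner_Integration.integrable_diff integrable_mult_right; simp)+
  have fg: "integrable \<pi> (\<lambda>z. ?f (fst z) + ?g (snd z))"
    by (rule Bochner_Integration.integrable_add[OF conjunct1[OF L[OF f]] conjunct1[OF R[OF g]]])
  have d': "integrable \<pi> (\<lambda>z. 1/2 * ?d z)"
    using d by (rule integrable_mult_right)
  show "integrable \<pi> ?c"
    unfolding c_eq by (rule Bochner_Integration.integrable_add[OF fg d'])
  have "integral\<^sup>L \<pi> ?c = (\<integral>z. ?f (fst z) + ?g (snd z) \<partial>\<pi>) + (\<integral>z. 1/2 * ?d z \<partial>\<pi>)"
    unfolding c_eq by (rule Bochner_Integration.integral_add[OF fg d'])
  also have "(\<integral>z. ?f (fst z) + ?g (snd z) \<partial>\<pi>) = (\<integral>z. ?f (fst z) \<partial>\<pi>) + (\<integral>z. ?g (snd z) \<partial>\<pi>)"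
    by (rule Bochner_Integration.integral_add[OF conjunct1[OF L[OF f]] conjunct1[OF R[OF g]]])
  also have "(\<integral>z. ?f (fst z) \<partial>\<pi>) = integral\<^sup>L \<mu> ?f"
    by (rule conjunct2[OF L[OF f]])
  also have "(\<integral>z. ?g (snd z) \<partial>\<pi>) = integral\<^sup>L \<nu> ?g"
    by (rule conjunct2[OF R[OF g]])
  also have "(\<integral>z. 1/2 * ?d z \<partial>\<pi>) = 1/2 * integral\<^sup>L \<pi> ?d"
    by (rule integral_mult_right_zero)
  finally show "integral\<^sup>L \<pi> ?c = integral\<^sup>L \<mu> ?f + integral\<^sup>L \<nu> ?g + 1/2 * integral\<^sup>L \<pi> ?d" .
qed

section \<open>Optimality of the Bregman transport map\<close>

theorem proposition2p10:
  fixes M :: "'m::topological_space set"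
    and X Y :: "'a::euclidean_space set"
    and \<Omega> \<Omega>s :: "'a \<Rightarrow> real"
    and \<iota> :: "'m \<Rightarrow> 'a"
    and \<mu>\<^sub>0 \<mu>\<^sub>1 :: "'m measure"
    and \<mu>X \<mu>Y :: "'a measure"
    and Df :: "'a \<Rightarrow> 'a"
    and T :: "'m \<Rightarrow> 'm"
    and B :: "'m \<Rightarrow> 'm \<Rightarrow> real"
  assumes manifold: "bregman_manifold M X \<Omega> \<iota>"
    and Y: "Y = dual_domain X \<Omega>"
    and \<Omega>s: "\<Omega>s = legendre X \<Omega>"
    and B: "B = bregman_div X \<Omega> \<iota>"
    and \<mu>\<^sub>0: "\<mu>\<^sub>0 \<in> borel_probs M"
    and \<mu>\<^sub>1: "\<mu>\<^sub>1 \<in> borel_probs M"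
    and \<mu>X: "\<mu>X = distr \<mu>\<^sub>0 borel \<iota>"
    and \<mu>Y: "\<mu>Y = distr \<mu>\<^sub>1 borel (dual_chart \<Omega> \<iota>)"
    and moments: "finite_second_moment \<mu>X" "finite_second_moment \<mu>Y"
    and ac: "absolutely_continuous lborel \<mu>X"
    and L1: "set_integrable \<mu>X X \<Omega>" "set_integrable \<mu>Y Y \<Omega>s"
    and brenier: "optimal_brenier_map \<mu>X \<mu>Y Df"
    and T: "T = bregman_transport_map M X \<Omega> \<iota> Df"
  shows "(AE x in \<mu>X. Df x \<in> Y) \<and>
    T \<in> measurable \<mu>\<^sub>0 \<mu>\<^sub>1 \<and>
    optimal_coupling (\<lambda>p q. ennreal (B p q)) \<mu>\<^sub>0 \<mu>\<^sub>1
      (distr \<mu>\<^sub>0 (\<mu>\<^sub>0 \<Otimes>\<^sub>M \<mu>\<^sub>1) (\<lambda>p. (p, T p))) \<and>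
    integrable \<mu>\<^sub>0 (\<lambda>p. B p (T p)) \<and>
    transport_cost (\<lambda>p q. ennreal (B p q)) \<mu>\<^sub>0 \<mu>\<^sub>1 = ennreal (\<integral>p. B p (T p) \<partial>\<mu>\<^sub>0) \<and>
    wasserstein2_sq \<mu>X \<mu>Y < \<infinity> \<and>
    set_integrable \<mu>X X (\<lambda>x. \<Omega> x - 1/2 * (norm x)\<^sup>2) \<and>
    set_integrable \<mu>Y Y (\<lambda>y. \<Omega>s y - 1/2 * (norm y)\<^sup>2) \<and>
    (\<integral>p. B p (T p) \<partial>\<mu>\<^sub>0) =
      1/2 * enn2real (wasserstein2_sq \<mu>X \<mu>Y)
      + (LINT x:X|\<mu>X. \<Omega> x - 1/2 * (norm x)\<^sup>2)
      + (LINT y:Y|\<mu>Y. \<Omega>s y - 1/2 * (norm y)\<^sup>2)"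
proof -
  let ?\<delta> = "dual_chart \<Omega> \<iota>"
  have reg: "regular_bregman_generator X \<Omega>"
    using manifold by (simp add: bregman_manifold_def)
  obtain \<kappa> where hom: "homeomorphism M X \<iota> \<kappa>"
    using manifold by (auto simp: bregman_manifold_def)
  obtain \<kappa>' where hom': "homeomorphism M Y ?\<delta> \<kappa>'"
    using dual_chart_homeomorphism[OF reg hom] Y by blast
  have Yb[measurable]: "Y \<in> sets borel"
    using open_dual_domain[OF reg] Y by (simp add: borel_open)
  have \<iota>X: "\<iota> p \<in> X" and \<delta>Y: "?\<delta> p \<in> Y" if "p \<in> M" for p
    using that hom hom' by (auto simp: homeomorphism_def)
  have sets0: "sets \<mu>\<^sub>0 = sets (restrict_space borel M)"
    and sets1: "sets \<mu>\<^sub>1 = sets (restrict_space borel M)"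
    using \<mu>\<^sub>0 \<mu>\<^sub>1 by (auto simp: borel_probs_def)
  have sp: "space \<mu>\<^sub>0 = M" "space \<mu>\<^sub>1 = M"
    using sets_eq_imp_space_eq[OF sets0] sets_eq_imp_space_eq[OF sets1]
    by (auto simp: space_restrict_space)
  have \<iota>m[measurable]: "\<iota> \<in> borel_measurable \<mu>\<^sub>0"
    by (rule homeomorphism_measurable[OF hom sets0])
  have \<delta>m[measurable]: "?\<delta> \<in> borel_measurable \<mu>\<^sub>1"
    by (rule homeomorphism_measurable[OF hom' sets1])
  have Dfm[measurable]: "Df \<in> borel_measurable borel"
    and push: "distr \<mu>X borel Df = \<mu>Y"
    and Df_opt: "(\<integral>\<^sup>+x. ennreal ((norm (x - Df x))\<^sup>2) \<partial>\<mu>X) = wasserstein2_sq \<mu>X \<mu>Y"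
    using brenier by (auto simp: optimal_brenier_map_def ae_convex_gradient_def)
  have setsX[measurable_cong]: "sets \<mu>X = sets borel" and setsY[measurable_cong]: "sets \<mu>Y = sets borel"
    by (auto simp: \<mu>X \<mu>Y)

  \<comment> \<open>The image of \<open>\<mu>\<^sub>1\<close> under the dual chart is carried by \<open>Y\<close>; being also the
    image of \<open>\<mu>X\<close> under \<open>Df\<close>, it forces \<open>Df\<close> into \<open>Y\<close> almost everywhere.\<close>
  have "AE y in \<mu>Y. y \<in> Y"
    unfolding \<mu>Y by (subst AE_distr_iff) (auto simp: sp \<delta>Y)
  then have AE_Y: "AE x in \<mu>X. Df x \<in> Y"
    unfolding push[symmetric] by (subst (asm) AE_distr_iff) auto
  then have AE_Y0: "AE p in \<mu>\<^sub>0. Df (\<iota> p) \<in> Y"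
    unfolding \<mu>X by (subst (asm) AE_distr_iff) auto

  have inv_\<delta>: "inv_into M ?\<delta> y = \<kappa>' y" if "y \<in> Y" for y
  proof -
    have "inj_on ?\<delta> M" using hom' by (auto simp: homeomorphism_def inj_on_def) metis
    moreover have "\<kappa>' y \<in> M" "?\<delta> (\<kappa>' y) = y" using hom' that by (auto simp: homeomorphism_def)
    ultimately show ?thesis using inv_into_f_f by metis
  qed
  have T_eq: "T = (\<lambda>p. if Df (\<iota> p) \<in> Y then \<kappa>' (Df (\<iota> p)) else p)"
    unfolding T bregman_transport_map_def Y[symmetric] by (auto simp: inv_\<delta>)
  have T_M: "T p \<in> M" if "p \<in> M" for p
    using that hom' by (auto simp: T_eq homeomorphism_def)
  have \<delta>T: "?\<delta> (T p) = Df (\<iota> p)" if "Df (\<iota> p) \<in> Y" for p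
    using that hom' by (simp add: T_eq homeomorphism_def)
  have "\<kappa>' \<in> borel_measurable (restrict_space borel Y)"
    using hom' by (intro borel_measurable_continuous_on_restrict) (auto simp: homeomorphism_def)
  moreover have "(\<lambda>p. Df (\<iota> p)) \<in> measurable (restrict_space \<mu>\<^sub>0 {p. Df (\<iota> p) \<in> Y}) (restrict_space borel Y)"
    by (intro measurable_restrict_space2 measurable_restrict_space1) (auto simp: space_restrict_space)
  ultimately have k: "(\<lambda>p. \<kappa>' (Df (\<iota> p))) \<in> borel_measurable (restrict_space \<mu>\<^sub>0 {p. Df (\<iota> p) \<in> Y})"
    by (rule measurable_compose[rotated])
  have "(\<lambda>p. p) \<in> borel_measurable \<mu>\<^sub>0"
    unfolding measurable_cong_sets[OF sets0 refl] by (intro measurable_restrict_space1) simp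
  then have "T \<in> borel_measurable \<mu>\<^sub>0"
    unfolding T_eq using k
    by (subst measurable_If_restrict_space_iff) (auto intro: measurable_restrict_space1)
  then have Tm[measurable]: "T \<in> measurable \<mu>\<^sub>0 \<mu>\<^sub>1"
    unfolding measurable_cong_sets[OF refl sets1]
    by (intro measurable_restrict_space2) (auto simp: sp T_M)

  have T_push: "distr \<mu>\<^sub>0 \<mu>\<^sub>1 T = \<mu>\<^sub>1"
  proof (rule measure_eqI_homeomorphism[OF hom' Yb])
    show "sets (distr \<mu>\<^sub>0 \<mu>\<^sub>1 T) = sets (restrict_space borel M)" using sets1 by simp
    have "distr (distr \<mu>\<^sub>0 \<mu>\<^sub>1 T) borel ?\<delta> = distr \<mu>\<^sub>0 borel (\<lambda>p. ?\<delta> (T p))"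
      by (simp add: distr_distr o_def)
    also have "\<dots> = distr \<mu>\<^sub>0 borel (\<lambda>p. Df (\<iota> p))"
      using AE_Y0 by (intro distr_cong_AE) (auto simp: \<delta>T)
    also have "\<dots> = \<mu>Y"
      by (simp add: push[symmetric] \<mu>X distr_distr o_def)
    finally show "distr (distr \<mu>\<^sub>0 \<mu>\<^sub>1 T) borel ?\<delta> = distr \<mu>\<^sub>1 borel ?\<delta>" by (simp add: \<mu>Y)
  qed (rule sets1)

  \<comment> \<open>The generator and its conjugate are only controlled on \<open>X\<close> and \<open>Y\<close>; cutting them off there
    makes them Borel functions on the whole space.\<close>
  define \<phi> where "\<phi> = (\<lambda>p. indicator X (\<iota> p) *\<^sub>R \<Omega> (\<iota> p))"
  define \<psi> where "\<psi> = (\<lambda>q. indicator Y (?\<delta> q) *\<^sub>R \<Omega>s (?\<delta> q))"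
  have B_eq: "B p q = \<phi> p + \<psi> q - \<iota> p \<bullet> ?\<delta> q" if "p \<in> M" "q \<in> M" for p q
    using that by (simp add: B bregman_div_def \<phi>_def \<psi>_def \<iota>X \<delta>Y \<Omega>s)
  have B_nonneg: "0 \<le> B p q" if "p \<in> M" "q \<in> M" for p q
    unfolding B using that by (intro bregman_div_nonneg[OF reg] \<iota>X)
  have \<phi>_int: "integrable \<mu>\<^sub>0 \<phi>"
    using L1(1) integrable_distr_eq[OF \<iota>m, of "\<lambda>x. indicator X x *\<^sub>R \<Omega> x"]
      borel_measurable_integrable[OF L1(1)[unfolded set_integrable_def]]
    by (simp add: set_integrable_def \<phi>_def \<mu>X)
  have \<psi>_int: "integrable \<mu>\<^sub>1 \<psi>"
    using L1(2) integrable_distr_eq[OF \<delta>m, of "\<lambda>x. indicator Y x *\<^sub>R \<Omega>s x"]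
      borel_measurable_integrable[OF L1(2)[unfolded set_integrable_def]]
    by (simp add: set_integrable_def \<psi>_def \<mu>Y)
  have m2X: "integrable \<mu>X (\<lambda>x. (norm x)\<^sup>2)" and m2Y: "integrable \<mu>Y (\<lambda>x. (norm x)\<^sup>2)"
    using moments by (auto simp: finite_second_moment_def)
  have \<iota>2: "integrable \<mu>\<^sub>0 (\<lambda>p. (norm (\<iota> p))\<^sup>2)"
    using m2X by (simp add: \<mu>X integrable_distr_eq)
  have \<delta>2: "integrable \<mu>\<^sub>1 (\<lambda>q. (norm (?\<delta> q))\<^sup>2)"
    using m2Y by (simp add: \<mu>Y integrable_distr_eq)
  have Xb[measurable]: "X \<in> sets borel"
    using generator_open[OF reg] by (rule borel_open)
  have intX: "set_integrable \<mu>X X (\<lambda>x. \<Omega> x - 1/2 * (norm x)\<^sup>2)"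
    by (intro set_integral_diff(1) L1, unfold set_integrable_def)
      (intro integrable_mult_indicator integrable_mult_right m2X, simp add: setsX)
  have intY: "set_integrable \<mu>Y Y (\<lambda>y. \<Omega>s y - 1/2 * (norm y)\<^sup>2)"
    by (intro set_integral_diff(1) L1, unfold set_integrable_def)
      (intro integrable_mult_indicator integrable_mult_right m2Y, simp add: setsY)
  let ?KX = "LINT x:X|\<mu>X. \<Omega> x - 1/2 * (norm x)\<^sup>2" and ?KY = "LINT y:Y|\<mu>Y. \<Omega>s y - 1/2 * (norm y)\<^sup>2"
  have "?KX = (\<integral>p. indicator X (\<iota> p) *\<^sub>R (\<Omega> (\<iota> p) - 1/2 * (norm (\<iota> p))\<^sup>2) \<partial>\<mu>\<^sub>0)"
    using integral_distr[OF \<iota>m, of "\<lambda>x. indicator X x *\<^sub>R (\<Omega> x - 1/2 * (norm x)\<^sup>2)"]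
      borel_measurable_integrable[OF intX[unfolded set_integrable_def]]
    by (simp add: set_lebesgue_integral_def \<mu>X)
  also have "\<dots> = (\<integral>p. \<phi> p - 1/2 * (norm (\<iota> p))\<^sup>2 \<partial>\<mu>\<^sub>0)"
    by (intro Bochner_Integration.integral_cong) (auto simp: sp \<phi>_def \<iota>X)
  finally have KX: "?KX = (\<integral>p. \<phi> p - 1/2 * (norm (\<iota> p))\<^sup>2 \<partial>\<mu>\<^sub>0)" .
  have "?KY = (\<integral>q. indicator Y (?\<delta> q) *\<^sub>R (\<Omega>s (?\<delta> q) - 1/2 * (norm (?\<delta> q))\<^sup>2) \<partial>\<mu>\<^sub>1)"
    using integral_distr[OF \<delta>m, of "\<lambda>x. indicator Y x *\<^sub>R (\<Omega>s x - 1/2 * (norm x)\<^sup>2)"]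
      borel_measurable_integrable[OF intY[unfolded set_integrable_def]]
    by (simp add: set_lebesgue_integral_def \<mu>Y)
  also have "\<dots> = (\<integral>q. \<psi> q - 1/2 * (norm (?\<delta> q))\<^sup>2 \<partial>\<mu>\<^sub>1)"
    by (intro Bochner_Integration.integral_cong) (auto simp: sp \<psi>_def \<delta>Y)
  finally have KY: "?KY = (\<integral>q. \<psi> q - 1/2 * (norm (?\<delta> q))\<^sup>2 \<partial>\<mu>\<^sub>1)" .

  define J where "J = (\<lambda>\<pi>. \<integral>z. (norm (\<iota> (fst z) - ?\<delta> (snd z)))\<^sup>2 \<partial>\<pi>)"
  have cost: "(\<integral>\<^sup>+z. ennreal (B (fst z) (snd z)) \<partial>\<pi>) = ennreal (?KX + ?KY + 1/2 * J \<pi>)"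
      and cost_integral: "integrable \<pi> (\<lambda>z. B (fst z) (snd z))"
        "(\<integral>z. B (fst z) (snd z) \<partial>\<pi>) = ?KX + ?KY + 1/2 * J \<pi>"
      and J_nn: "(\<integral>\<^sup>+z. ennreal ((norm (\<iota> (fst z) - ?\<delta> (snd z)))\<^sup>2) \<partial>\<pi>) = ennreal (J \<pi>)"
      and J_nonneg: "0 \<le> J \<pi>"
    if \<pi>: "\<pi> \<in> couplings \<mu>\<^sub>0 \<mu>\<^sub>1" for \<pi>
  proof -
    note split = coupling_cost_split[OF \<pi> \<phi>_int \<psi>_int \<iota>m \<delta>m \<iota>2 \<delta>2]
    have M: "fst z \<in> M" "snd z \<in> M" if "z \<in> space \<pi>" for z
      using couplings_measurable[OF \<pi>, THEN measurable_space, OF that] by (auto simp: sp)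
    have Bc: "B (fst z) (snd z) = \<phi> (fst z) + \<psi> (snd z) - \<iota> (fst z) \<bullet> ?\<delta> (snd z)"
      if "z \<in> space \<pi>" for z
      using M[OF that] by (rule B_eq)
    show int: "integrable \<pi> (\<lambda>z. B (fst z) (snd z))"
      using split(2) by (subst Bochner_Integration.integrable_cong[OF refl Bc])
    show val: "(\<integral>z. B (fst z) (snd z) \<partial>\<pi>) = ?KX + ?KY + 1/2 * J \<pi>"
      using split(3) unfolding KX KY J_def
      by (subst Bochner_Integration.integral_cong[OF refl Bc])
    show "(\<integral>\<^sup>+z. ennreal (B (fst z) (snd z)) \<partial>\<pi>) = ennreal (?KX + ?KY + 1/2 * J \<pi>)"
      using nn_integral_eq_integral[OF int] M B_nonneg val by (auto intro!: AE_I2)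
    show "(\<integral>\<^sup>+z. ennreal ((norm (\<iota> (fst z) - ?\<delta> (snd z)))\<^sup>2) \<partial>\<pi>) = ennreal (J \<pi>)"
      unfolding J_def using split(1) by (intro nn_integral_eq_integral) auto
    show "0 \<le> J \<pi>" by (simp add: J_def)
  qed

  have W_le: "wasserstein2_sq \<mu>X \<mu>Y \<le> ennreal (J \<pi>)" if \<pi>: "\<pi> \<in> couplings \<mu>\<^sub>0 \<mu>\<^sub>1" for \<pi>
  proof -
    note [measurable] = couplings_measurable[OF \<pi>]
    let ?\<pi>' = "distr \<pi> (borel \<Otimes>\<^sub>M borel) (\<lambda>z. (\<iota> (fst z), ?\<delta> (snd z)))"
    have "?\<pi>' \<in> couplings \<mu>X \<mu>Y"
      unfolding \<mu>X \<mu>Y by (rule coupling_pushforward[OF \<pi> \<iota>m \<delta>m])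
    then have "wasserstein2_sq \<mu>X \<mu>Y \<le> (\<integral>\<^sup>+z. ennreal ((norm (fst z - snd z))\<^sup>2) \<partial>?\<pi>')"
      unfolding wasserstein2_sq_def transport_cost_def by (rule INF_lower)
    also have "\<dots> = ennreal (J \<pi>)"
      by (subst nn_integral_distr) (auto simp: J_nn[OF \<pi>])
    finally show ?thesis .
  qed

  let ?\<pi> = "distr \<mu>\<^sub>0 (\<mu>\<^sub>0 \<Otimes>\<^sub>M \<mu>\<^sub>1) (\<lambda>p. (p, T p))"
  have \<pi>: "?\<pi> \<in> couplings \<mu>\<^sub>0 \<mu>\<^sub>1"
    by (rule graph_coupling[OF Tm T_push])
  have "ennreal (J ?\<pi>) = (\<integral>\<^sup>+p. ennreal ((norm (\<iota> p - ?\<delta> (T p)))\<^sup>2) \<partial>\<mu>\<^sub>0)"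
    unfolding J_nn[OF \<pi>, symmetric] by (subst nn_integral_distr) auto
  also have "\<dots> = (\<integral>\<^sup>+p. ennreal ((norm (\<iota> p - Df (\<iota> p)))\<^sup>2) \<partial>\<mu>\<^sub>0)"
    using AE_Y0 by (intro nn_integral_cong_AE) (auto simp: \<delta>T)
  also have "\<dots> = wasserstein2_sq \<mu>X \<mu>Y"
    using Df_opt by (simp add: \<mu>X nn_integral_distr)
  finally have W: "wasserstein2_sq \<mu>X \<mu>Y = ennreal (J ?\<pi>)" by simp

  have optimal: "transport_cost (\<lambda>p q. ennreal (B p q)) \<mu>\<^sub>0 \<mu>\<^sub>1 = ennreal (?KX + ?KY + 1/2 * J ?\<pi>)"
    unfolding transport_cost_def
  proof (rule antisym)
    show "(INF \<pi>\<in>couplings \<mu>\<^sub>0 \<mu>\<^sub>1. \<integral>\<^sup>+z. ennreal (B (fst z) (snd z)) \<partial>\<pi>)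
        \<le> ennreal (?KX + ?KY + 1/2 * J ?\<pi>)"
      using INF_lower[OF \<pi>, of "\<lambda>\<pi>. \<integral>\<^sup>+z. ennreal (B (fst z) (snd z)) \<partial>\<pi>"] cost[OF \<pi>] by simp
    show "ennreal (?KX + ?KY + 1/2 * J ?\<pi>)
        \<le> (INF \<pi>\<in>couplings \<mu>\<^sub>0 \<mu>\<^sub>1. \<integral>\<^sup>+z. ennreal (B (fst z) (snd z)) \<partial>\<pi>)"
    proof (rule INF_greatest)
      fix \<rho> assume \<rho>: "\<rho> \<in> couplings \<mu>\<^sub>0 \<mu>\<^sub>1"
      have "J ?\<pi> \<le> J \<rho>"
        using W_le[OF \<rho>] J_nonneg[OF \<rho>] by (simp add: W)
      then show "ennreal (?KX + ?KY + 1/2 * J ?\<pi>) \<le> (\<integral>\<^sup>+z. ennreal (B (fst z) (snd z)) \<partial>\<rho>)"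
        unfolding cost[OF \<rho>] by (intro ennreal_leI) simp
    qed
  qed

  have Bm: "(\<lambda>z. B (fst z) (snd z)) \<in> borel_measurable (\<mu>\<^sub>0 \<Otimes>\<^sub>M \<mu>\<^sub>1)"
    using borel_measurable_integrable[OF cost_integral(1)[OF \<pi>]] by simp
  have g: "(\<lambda>p. (p, T p)) \<in> measurable \<mu>\<^sub>0 (\<mu>\<^sub>0 \<Otimes>\<^sub>M \<mu>\<^sub>1)"
    using Tm by (intro measurable_Pair) auto
  have B_int: "integrable \<mu>\<^sub>0 (\<lambda>p. B p (T p))"
    using cost_integral(1)[OF \<pi>] integrable_distr_eq[OF g Bm] by simp
  have B_val: "(\<integral>p. B p (T p) \<partial>\<mu>\<^sub>0) = ?KX + ?KY + 1/2 * J ?\<pi>"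
    using cost_integral(2)[OF \<pi>] integral_distr[OF g Bm] by simp
  have "optimal_coupling (\<lambda>p q. ennreal (B p q)) \<mu>\<^sub>0 \<mu>\<^sub>1 ?\<pi>"
    unfolding optimal_coupling_def optimal cost[OF \<pi>] using \<pi> by simp
  moreover have "wasserstein2_sq \<mu>X \<mu>Y < \<infinity>" by (simp add: W)
  moreover have "(\<integral>p. B p (T p) \<partial>\<mu>\<^sub>0) = 1/2 * enn2real (wasserstein2_sq \<mu>X \<mu>Y) + ?KX + ?KY"
    unfolding B_val W by (simp add: J_nonneg[OF \<pi>])
  ultimately show ?thesis
    using AE_Y Tm B_int intX intY optimal B_val by simp
qed

end
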